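(* Let $m$ be a positive integer, $F=\mathbb{F}_{2^m}$, and let $a\in F\setminus\{0,1\}$ be a third root of unity (i.e. $a^3=1$, equivalently $a^2+a+1=0$). Then \[ K(a)\equiv\begin{cases}7\pmod{12}, & \text{if } \mathrm{Tr}(a)=0,\\ 11\pmod{12}, & \text{if } \mathrm{Tr}(a)=1.\end{cases} \]
   Context: $\mathrm{Tr}$ denotes the absolute trace from $F=\mathbb{F}_{2^m}$ to $\mathbb{F}_2$, $\mathrm{Tr}(x)=\sum_{i=0}^{m-1}x^{2^i}$. For $a\in F\setminus\{0\}$, the Kloosterman sum is $K(a)=\sum_{x\in F\setminus\{0\}}(-1)^{\mathrm{Tr}(ax+1/x)}$. *)

theory Defs
  imports "HOL-Number_Theory.Number_Theory" "HOL-Library.Cardinality"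
begin

definition abs_trace :: "nat \<Rightarrow> 'a::field \<Rightarrow> 'a" where
  "abs_trace m x = (\<Sum>i<m. x ^ (2 ^ i))"

text \<open>The absolute trace takes its values in the prime field \<open>{0, 1}\<close> of the ambient type;
  \<open>bit_of\<close> turns such a value into an exponent for \<open>-1\<close>.\<close>

definition bit_of :: "'a::field \<Rightarrow> nat" where
  "bit_of t = (if t = 0 then 0 else 1)"

definition kloosterman :: "nat \<Rightarrow> 'a::{field,finite} \<Rightarrow> int" where
  "kloosterman m a = (\<Sum>x\<in>UNIV - {0}. (-1) ^ bit_of (abs_trace m (a * x + 1 / x)))"

end

theory Submission
  imports Defs "HOL-Library.Disjoint_Sets" "HOL-Computational_Algebra.Polynomial"
begin

text \<open>
  Let \<open>q = 2\<^sup>m\<close>. Modulo 4: the involution \<open>x \<mapsto> 1 / (a x)\<close> of the nonzero \<open>x\<close> with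
  \<open>Tr (a x + 1 / x) = 0\<close> has the single fixed point \<open>x\<^sup>2 = 1 / a\<close>, so there is an odd number \<open>N\<close>
  of such \<open>x\<close>, and \<open>K(a) = 2 N - (q - 1)\<close>.

  Modulo 3: the elliptic curve attached to \<open>K(a)\<close>, twisted when \<open>Tr a = 1\<close>, has a rational point of
  order 3 and can therefore be brought into the cyclically symmetric form
  \<open>u + v + w = 1\<close>, \<open>u v w = a\<close>. The shift of coordinates acts freely on the solutions because
  \<open>a \<noteq> 1\<close>, so 3 divides their number. For fixed \<open>u \<notin> {0, 1}\<close> the number of solutions is
  \<open>1 + (-1) ^ Tr (a / (u (1 + u)\<^sup>2))\<close>, and substituting \<open>u = 1 / (1 + y)\<close> turns this trace into
  \<open>Tr (a + a y + 1 / y)\<close>, using \<open>a + a\<^sup>2 = 1\<close> and \<open>Tr (z\<^sup>2) = Tr z\<close>.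
  Hence the number of solutions is \<open>q - 2 + (-1) ^ Tr a * K(a)\<close>.
\<close>

section \<open>Orbit counting for a map of order 3\<close>

text \<open>The orbits \<open>{x, f x, f (f x)}\<close> partition \<open>S\<close>. Each has three
  elements: \<open>f (f x) = x\<close> would give \<open>x = f (f (f x)) = f x\<close>, which is
  excluded.\<close>

lemma three_dvd_card_if_free_order_3:
  assumes fin: "finite S"
    and f: "\<And>x. x \<in> S \<Longrightarrow> f x \<in> S" "\<And>x. x \<in> S \<Longrightarrow> f (f (f x)) = x"
      "\<And>x. x \<in> S \<Longrightarrow> f x \<noteq> x"
  shows "3 dvd card S"
proof -
  define C where "C = (\<lambda>x. {x, f x, f (f x)}) ` S"
  have U: "\<Union>C = S"
    using f by (auto simp: C_def)
  have "3 dvd card (\<Union>C)"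
  proof (rule dvd_partition)
    show "finite (\<Union>C)"
      using U fin by simp
    have "card {x, f x, f (f x)} = 3" if "x \<in> S" for x
    proof -
      have "f x \<noteq> x" "f (f x) \<noteq> f x" "f (f x) \<noteq> x"
        using f that by metis+
      then show ?thesis by auto
    qed
    then show "\<forall>c\<in>C. 3 dvd card c"
      by (auto simp: C_def)
    have orbit_eq: "{x, f x, f (f x)} = {y, f y, f (f y)}"
      if "x \<in> S" "y \<in> {x, f x, f (f x)}" for x y
      using that f by auto
    show "\<forall>c1\<in>C. \<forall>c2\<in>C. c1 \<noteq> c2 \<longrightarrow> c1 \<inter> c2 = {}"
    proof (intro ballI impI, rule ccontr)
      fix c1 c2
      assume "c1 \<in> C" "c2 \<in> C" and ne: "c1 \<noteq> c2" and "c1 \<inter> c2 \<noteq> {}"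
      then obtain x y z where "x \<in> S" "y \<in> S" and c: "c1 = {x, f x, f (f x)}" "c2 = {y, f y, f (f y)}"
        and "z \<in> c1" "z \<in> c2"
        unfolding C_def by blast
      then have "c1 = {z, f z, f (f z)}" "c2 = {z, f z, f (f z)}"
        using orbit_eq by metis+
      with ne show False by simp
    qed
  qed
  then show ?thesis
    by (simp only: U)
qed

section \<open>Finite fields and characteristic 2\<close>

text \<open>Multiplication by a nonzero \<open>x\<close> permutes the nonzero elements, so comparing
  their products before and after gives \<open>x ^ (CARD('a) - 1) = 1\<close>.\<close>

lemma power_card_eq_same:
  fixes x :: "'a::{field,finite}"
  shows "x ^ CARD('a) = x"
proof (cases "x = 0")
  case False
  have "(\<Prod>y\<in>UNIV-{0}. y) = (\<Prod>y\<in>UNIV-{0}. x * y)"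
    by (rule prod.reindex_bij_witness[of _ "\<lambda>y. x * y" "\<lambda>y. y / x"]) (use False in auto)
  also have "\<dots> = x ^ (CARD('a) - 1) * (\<Prod>y\<in>UNIV-{0}. y)"
    by (simp add: prod.distrib)
  finally have "x ^ (CARD('a) - 1) = 1"
    by simp
  then show ?thesis
    by (simp add: power_eq_if[of x "CARD('a)"])
qed simp

text \<open>Since \<open>a ^ CARD('a) = a\<close>, only the exponent modulo 3 matters: residue 0
  gives \<open>a = 1\<close>, and residue 2 gives \<open>a * a = a\<close>, again
  \<open>a = 1\<close>.\<close>

lemma card_cong_1_mod_3:
  fixes a :: "'a::{field,finite}"
  assumes "a \<noteq> 1" "a ^ 3 = 1"
  shows "[CARD('a) = 1] (mod 3)"
proof -
  have "a ^ (CARD('a) mod 3) = a ^ (CARD('a) mod 3 + 3 * (CARD('a) div 3))"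
    by (simp only: power_add power_mult assms(2)) simp
  also have "\<dots> = a"
    using power_card_eq_same[of a] by simp
  finally have "a ^ (CARD('a) mod 3) = a" .
  moreover have "CARD('a) mod 3 = 0 \<or> CARD('a) mod 3 = 1 \<or> CARD('a) mod 3 = 2"
    by linarith
  moreover have "a \<noteq> 0"
    using assms(2) by auto
  ultimately show ?thesis
    using assms(1) by (elim disjE) (simp_all add: power2_eq_square cong_def)
qed

lemma CHAR_eq_2_if_card_power_2:
  assumes "CARD('a::{field,finite}) = 2 ^ m"
  shows "CHAR('a) = 2"
proof -
  have "prime CHAR('a)"
    by (intro prime_CHAR_semidom finite_imp_CHAR_pos) simp
  moreover have "CHAR('a) dvd 2 ^ m"
    using CHAR_dvd_CARD[where ?'a = 'a] assms by simp
  ultimately show ?thesis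
    by (meson prime_dvd_power primes_dvd_imp_eq two_is_prime_nat)
qed

lemma add_self_CHAR_2:
  fixes x :: "'a::ring_1"
  assumes "CHAR('a) = 2"
  shows "x + x = 0"
  using uminus_CHAR_2[OF assms, of x] by (metis add.right_inverse)

lemma add_left_self_CHAR_2:
  fixes x :: "'a::ring_1"
  assumes "CHAR('a) = 2"
  shows "x + (x + y) = y"
  using add_self_CHAR_2[OF assms, of x] by (simp flip: add.assoc)

lemma add_eq_0_iff_CHAR_2:
  fixes x y :: "'a::ring_1"
  assumes "CHAR('a) = 2"
  shows "x + y = 0 \<longleftrightarrow> x = y"
  by (simp add: add_eq_0_iff2 uminus_CHAR_2[OF assms])

lemma power2_add_CHAR_2:
  fixes x y :: "'a::comm_ring_1"
  assumes "CHAR('a) = 2"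
  shows "(x + y)\<^sup>2 = x\<^sup>2 + y\<^sup>2"
  by (rule freshmans_dream) (simp_all add: assms)

lemma inj_power2_CHAR_2:
  fixes x y :: "'a::idom"
  assumes "CHAR('a) = 2" "x\<^sup>2 = y\<^sup>2"
  shows "x = y"
  using assms(2) by (simp add: power2_eq_iff uminus_CHAR_2[OF assms(1)])

text \<open>Each pair \<open>x\<close>, \<open>h x\<close> contributes \<open>1 + 1 = 0\<close> to
  the sum of ones over \<open>S\<close> in \<open>gf2\<close>, where that sum is the cardinality
  modulo 2.\<close>

lemma even_card_if_involution:
  assumes "\<And>x. x \<in> S \<Longrightarrow> h x \<in> S" "\<And>x. x \<in> S \<Longrightarrow> h (h x) = x" "\<And>x. x \<in> S \<Longrightarrow> h x \<noteq> x"
  shows "even (card S)"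
proof -
  have two: "(1 :: gf2) + 1 = 0"
    by transfer simp
  have "(\<Sum>x\<in>S. (1 :: gf2)) = 0"
    by (rule sum_involution_eq_0[where h = h]) (use two assms in auto)
  then have "CHAR(gf2) dvd card S"
    by (simp add: of_nat_eq_0_iff_char_dvd)
  moreover have "CHAR(gf2) = 2"
    by (rule CHAR_eq_posI) (use two in \<open>auto simp: less_2_cases_iff\<close>)
  ultimately show ?thesis
    by simp
qed

section \<open>The absolute trace and the Artin-Schreier map\<close>

lemma abs_trace_add:
  fixes x y :: "'a::{field,finite}"
  assumes "CHAR('a) = 2"
  shows "abs_trace m (x + y) = abs_trace m x + abs_trace m y"
  unfolding abs_trace_def sum.distrib[symmetric]
  by (intro sum.cong refl freshmans_dream') (use assms in auto)

lemma abs_trace_power2_eq_power2: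
  fixes x :: "'a::{field,finite}"
  assumes "CHAR('a) = 2"
  shows "abs_trace m (x\<^sup>2) = (abs_trace m x)\<^sup>2"
  unfolding abs_trace_def
  by (subst freshmans_dream_sum[where n = 2])
    (use assms in \<open>auto simp: mult.commute simp flip: power_mult\<close>)

text \<open>Squaring shifts the exponents \<open>2 ^ i\<close> by one step, and the new last term
  \<open>x ^ 2 ^ m\<close> is \<open>x\<close>, the term lost at the start.\<close>

lemma abs_trace_power2:
  fixes x :: "'a::{field,finite}"
  assumes "CARD('a) = 2 ^ m"
  shows "abs_trace m (x\<^sup>2) = abs_trace m x"
proof -
  have "abs_trace m (x\<^sup>2) + x = (\<Sum>i<m. x ^ 2 ^ Suc i) + x ^ 2 ^ 0"
    by (simp add: abs_trace_def power_mult[symmetric] mult.commute)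
  also have "\<dots> = (\<Sum>i<Suc m. x ^ 2 ^ i)"
    by (simp only: sum.lessThan_Suc_shift add.commute)
  also have "\<dots> = abs_trace m x + x"
    using power_card_eq_same[of x] assms by (simp add: abs_trace_def)
  finally show ?thesis
    by simp
qed

lemma abs_trace_eq_0_or_1:
  fixes x :: "'a::{field,finite}"
  assumes "CARD('a) = 2 ^ m"
  shows "abs_trace m x = 0 \<or> abs_trace m x = 1"
proof -
  have "(abs_trace m x)\<^sup>2 = abs_trace m x"
    using abs_trace_power2_eq_power2[OF CHAR_eq_2_if_card_power_2[OF assms], of m x]
      abs_trace_power2[OF assms, of x] by simp
  then show ?thesis
    by (simp add: power2_eq_square)
qed

text \<open>The trace is a polynomial function of degree at most \<open>2 ^ (m - 1)\<close>, nonzero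
  because its coefficient there is 1; the bound is the one on its number of roots.\<close>

lemma card_abs_trace_eq_0_le:
  assumes "m > 0"
  shows "card {z::'a::{field,finite}. abs_trace m z = 0} \<le> 2 ^ (m - 1)"
proof -
  define p :: "'a poly" where "p = (\<Sum>i<m. monom 1 (2 ^ i))"
  have "coeff p (2 ^ (m - 1)) = (\<Sum>i<m. if i = m - 1 then 1 else 0)"
    by (simp add: p_def coeff_sum)
  also have "\<dots> = 1"
    using assms by simp
  finally have "p \<noteq> 0"
    by auto
  moreover have "degree p \<le> 2 ^ (m - 1)"
    unfolding p_def
    by (intro degree_sum_le order_trans[OF degree_monom_le]) auto
  moreover have "poly p z = abs_trace m z" for z
    by (simp add: p_def abs_trace_def poly_sum poly_monom)
  ultimately show ?thesis
    using card_poly_roots_bound[of p] by simp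
qed

lemma artin_schreier_fibre:
  fixes t :: "'a::{field,finite}"
  assumes "CHAR('a) = 2"
  shows "{s. s\<^sup>2 + s = t\<^sup>2 + t} = {t, t + 1}"
proof -
  have "s\<^sup>2 + s = t\<^sup>2 + t \<longleftrightarrow> s = t \<or> s = t + 1" for s
  proof -
    have "s\<^sup>2 + s = t\<^sup>2 + t \<longleftrightarrow> (s - t) * (s + t + 1) = 0"
      by (auto simp: algebra_simps power2_eq_square)
    also have "\<dots> \<longleftrightarrow> s = t \<or> s = t + 1"
      using add_eq_0_iff_CHAR_2[OF assms, of s "t + 1"] by (simp add: add.assoc)
    finally show ?thesis .
  qed
  then show ?thesis by auto
qed

text \<open>The map \<open>t \<mapsto> t\<^sup>2 + t\<close> is two-to-one with image inside the kernel of the trace,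
  and the degree of the trace polynomial bounds the kernel by the size of that image.\<close>

lemma abs_trace_eq_0_iff:
  fixes z :: "'a::{field,finite}"
  assumes m: "m > 0" and card: "CARD('a) = 2 ^ m"
  shows "abs_trace m z = 0 \<longleftrightarrow> (\<exists>t. z = t\<^sup>2 + t)"
proof -
  note char = CHAR_eq_2_if_card_power_2[OF card]
  define g where "g = (\<lambda>t::'a. t\<^sup>2 + t)"
  have "card (UNIV :: 'a set) = (\<Sum>y\<in>range g. card {t. g t = y})"
    using sum.group[of "UNIV :: 'a set" "range g" g "\<lambda>_. 1::nat"] by simp
  also have "\<dots> = (\<Sum>y\<in>range g. 2)"
  proof (rule sum.cong[OF refl])
    fix y assume "y \<in> range g"
    then obtain t where "y = t\<^sup>2 + t"
      by (auto simp: g_def)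
    then show "card {t. g t = y} = 2"
      using artin_schreier_fibre[OF char, of t] by (simp add: g_def)
  qed
  finally have "card (range g) * 2 = 2 ^ m"
    using card by simp
  then have "card (range g) = 2 ^ (m - 1)"
    using m by (cases m) auto
  moreover have "range g \<subseteq> {z. abs_trace m z = 0}"
    using abs_trace_power2[OF card]
    by (auto simp: g_def abs_trace_add[OF char] add_self_CHAR_2[OF char])
  ultimately have "range g = {z. abs_trace m z = 0}"
    using card_abs_trace_eq_0_le[OF m, where ?'a = 'a]
    by (intro card_seteq) auto
  then show ?thesis
    by (auto simp: g_def)
qed

section \<open>The canonical additive character and quadratic equations\<close>

definition trace_char :: "nat \<Rightarrow> 'a::field \<Rightarrow> int" where
  "trace_char m z = (-1) ^ bit_of (abs_trace m z)"

lemma trace_char_eq: "trace_char m z = (if abs_trace m z = 0 then 1 else -1)"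
  by (simp add: trace_char_def bit_of_def)

lemma trace_char_add:
  fixes x y :: "'a::{field,finite}"
  assumes "CARD('a) = 2 ^ m"
  shows "trace_char m (x + y) = trace_char m x * trace_char m y"
  using abs_trace_eq_0_or_1[OF assms, of x] abs_trace_eq_0_or_1[OF assms, of y]
  using abs_trace_add[OF CHAR_eq_2_if_card_power_2[OF assms], of m x y]
    add_self_CHAR_2[OF CHAR_eq_2_if_card_power_2[OF assms], of 1]
  by (auto simp: trace_char_eq)

lemma card_artin_schreier_solutions:
  fixes z :: "'a::{field,finite}"
  assumes "m > 0" "CARD('a) = 2 ^ m"
  shows "int (card {t. t\<^sup>2 + t = z}) = 1 + trace_char m z"
proof (cases "abs_trace m z = 0")
  case True
  then obtain t where "z = t\<^sup>2 + t"
    using abs_trace_eq_0_iff[OF assms] by blast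
  with True show ?thesis
    using artin_schreier_fibre[OF CHAR_eq_2_if_card_power_2[OF assms(2)], of t]
    by (simp add: trace_char_eq)
next
  case False
  then have "{t. t\<^sup>2 + t = z} = {}"
    using abs_trace_eq_0_iff[OF assms, of z] by auto
  with False show ?thesis
    by (simp add: trace_char_eq)
qed

text \<open>The substitution \<open>v = c * t\<close>, followed by division by
  \<open>u * c\<^sup>2\<close>, normalises the equation to Artin-Schreier form.\<close>

lemma card_quadratic_solutions:
  fixes u c k :: "'a::{field,finite}"
  assumes "m > 0" "CARD('a) = 2 ^ m" "u \<noteq> 0" "c \<noteq> 0"
  shows "int (card {v. u * v * (c + v) = k}) = 1 + trace_char m (k / (u * c\<^sup>2))"
proof -
  have "u * (c * t) * (c + c * t) = k \<longleftrightarrow> t\<^sup>2 + t = k / (u * c\<^sup>2)" for t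
  proof -
    have "u * (c * t) * (c + c * t) = (t\<^sup>2 + t) * (u * c\<^sup>2)"
      by (simp add: algebra_simps power2_eq_square)
    then show ?thesis
      using assms(3,4) by (simp only: eq_divide_eq) simp
  qed
  moreover have "bij ((*) c)"
    by (rule bij_betw_byWitness[where f' = "\<lambda>v. v / c"]) (use assms(4) in auto)
  ultimately have "bij_betw ((*) c) {t. t\<^sup>2 + t = k / (u * c\<^sup>2)} {v. u * v * (c + v) = k}"
    by (intro bij_betw_Collect[of _ UNIV UNIV, simplified]) auto
  then show ?thesis
    by (simp flip: bij_betw_same_card card_artin_schreier_solutions[OF assms(1,2)])
qed

section \<open>The Kloosterman sum modulo 4\<close>

lemma kloosterman_cong_3_mod_4:
  fixes a :: "'a::{field,finite}"
  assumes m: "m \<ge> 2" and card: "CARD('a) = 2 ^ m" and a: "a \<noteq> 0"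
  shows "[kloosterman m a = 3] (mod 4)"
proof -
  note char = CHAR_eq_2_if_card_power_2[OF card]
  define A where "A = {x. x \<noteq> 0 \<and> abs_trace m (a * x + 1 / x) = 0}"
  \<comment> \<open>Raising to the power \<open>2 ^ (m - 1)\<close> inverts squaring, so
    \<open>b\<close> is the square root of \<open>1 / a\<close>.\<close>
  define b where "b = 1 / a ^ 2 ^ (m - 1)"
  have "b\<^sup>2 = 1 / a ^ 2 ^ m"
    using m by (simp add: b_def power_divide flip: power_mult power_Suc2)
  then have b2: "b\<^sup>2 = 1 / a"
    using power_card_eq_same[of a] card by simp
  then have b0: "b \<noteq> 0"
    using a by auto
  then have ab: "a * b = 1 / b"
    using a b2 by (simp add: field_simps power2_eq_square)
  then have bA: "b \<in> A"
    using b0 by (simp add: A_def add_self_CHAR_2[OF char] abs_trace_def zero_power)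
  have fixed: "x = b" if "x \<noteq> 0" "1 / (a * x) = x" for x
  proof (rule inj_power2_CHAR_2[OF char])
    show "x\<^sup>2 = b\<^sup>2"
      using that a unfolding b2 by (simp add: field_simps power2_eq_square)
  qed
  have "even (card (A - {b}))"
  \<comment> \<open>The involution swaps the summands of \<open>a * x + 1 / x\<close>, so it
    preserves \<open>A\<close>.\<close>
  proof (rule even_card_if_involution[where h = "\<lambda>x. 1 / (a * x)"])
    fix x assume x: "x \<in> A - {b}"
    then have x0: "x \<noteq> 0"
      by (simp add: A_def)
    show inv: "1 / (a * (1 / (a * x))) = x"
      using a x0 by simp
    show "1 / (a * x) \<noteq> x"
      using fixed[of x] x x0 by blast
    have "1 / (a * x) \<noteq> b"
      using fixed[of b] a b0 ab inv x by (auto simp: field_simps)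
    then show "1 / (a * x) \<in> A - {b}"
      using x a by (simp add: A_def add.commute)
  qed
  then have "odd (card A)"
    using bA card_Suc_Diff1[of A b] by (metis even_Suc finite)
  then obtain k where k: "card A = 2 * k + 1"
    by (rule oddE)
  \<comment> \<open>Here \<open>m \<ge> 2\<close> enters: the field has \<open>4 * 2 ^ j\<close>
    elements, which vanishes modulo 4.\<close>
  obtain j where j: "m = j + 2"
    using m by (metis add.commute le_Suc_ex)
  have "kloosterman m a = (\<Sum>x\<in>UNIV-{0}. 2 * of_bool (x \<in> A) - 1)"
    unfolding kloosterman_def
    by (rule sum.cong) (auto simp: A_def bit_of_def)
  also have "\<dots> = 2 * int (card A) - (int CARD('a) - 1)"
  proof -
    have "(UNIV - {0}) \<inter> A = A"
      by (auto simp: A_def)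
    then show ?thesis
      by (simp add: sum_subtractf sum.If_cases of_bool_def sum_distrib_left[symmetric]
          card_Diff_singleton of_nat_diff Int_def)
  qed
  also have "\<dots> = 3 + 4 * (int k - 2 ^ j)"
    using card by (simp add: k j algebra_simps)
  finally show ?thesis
    by (simp add: cong_iff_dvd_diff)
qed

section \<open>The Kloosterman sum modulo 3\<close>

lemma kloosterman_cube_root_of_unity_mod_3:
  fixes a :: "'a::{field,finite}"
  assumes m: "m > 0" and card: "CARD('a) = 2 ^ m"
    and a: "a \<noteq> 1" and a_pow: "a ^ 3 = 1"
  shows "[kloosterman m a = trace_char m a] (mod 3)"
proof -
  note char = CHAR_eq_2_if_card_power_2[OF card]
  note char2_simps = add_self_CHAR_2[OF char] add_left_self_CHAR_2[OF char]
  have a0: "a \<noteq> 0"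
    using a_pow by auto
  have a_sum: "a + a\<^sup>2 = 1"
  proof -
    have "(a - 1) * (1 + a + a\<^sup>2) = 0"
      using a_pow by (simp add: algebra_simps eval_nat_numeral)
    then show ?thesis
      using a add_eq_0_iff_CHAR_2[OF char, of 1 "a + a\<^sup>2"] by (auto simp: add.assoc)
  qed
  define S where "S = {(u, v, w). u + v + w = 1 \<and> u * v * w = a}"
  \<comment> \<open>\<open>n u\<close> counts the points of \<open>S\<close> over \<open>u\<close>,
    with \<open>w = 1 + u + v\<close> eliminated.\<close>
  define n where "n = (\<lambda>u. int (card {v. u * v * (1 + u + v) = a}))"

  have dvd: "3 dvd card S"
  proof (rule three_dvd_card_if_free_order_3[where f = "\<lambda>(u, v, w). (v, w, u)"])
    fix x assume x: "x \<in> S"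
    then show "(case x of (u, v, w) \<Rightarrow> (v, w, u)) \<in> S"
      by (auto simp: S_def ac_simps)
    \<comment> \<open>A fixed triple has \<open>u = v = w\<close>, hence
      \<open>u = u + u + u = 1\<close> and \<open>a = 1\<close>.\<close>
    show "(case x of (u, v, w) \<Rightarrow> (v, w, u)) \<noteq> x"
      using x a by (auto simp: S_def char2_simps)
  qed auto
  have "int (card S) = (\<Sum>u\<in>UNIV. n u)"
  proof -
    have "bij_betw (\<lambda>(u, v). (u, v, 1 + u + v)) (SIGMA u:UNIV. {v. u * v * (1 + u + v) = a}) S"
    proof (rule bij_betwI')
      fix y assume "y \<in> S"
      then obtain u v w where y: "y = (u, v, w)" "u + v + w = 1" "u * v * w = a"
        by (auto simp: S_def)
      then have "w = 1 + u + v"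
        by (metis add.commute add.left_commute add_left_self_CHAR_2[OF char])
      with y show "\<exists>x\<in>SIGMA u:UNIV. {v. u * v * (1 + u + v) = a}.
          y = (case x of (u, v) \<Rightarrow> (u, v, 1 + u + v))"
        by (intro bexI[of _ "(u, v)"]) auto
    qed (auto simp: S_def ac_simps char2_simps)
    then show ?thesis
      by (simp add: n_def bij_betw_same_card[symmetric])
  qed
  moreover have "(\<Sum>u\<in>UNIV. n u) = n 0 + n 1 + (\<Sum>u\<in>UNIV-{0,1}. n u)"
    by (simp add: sum.remove[of UNIV 0] sum.remove[of "UNIV-{0}" 1] Diff_insert2[symmetric])
  moreover have "n 0 = 0"
    using a0 by (simp add: n_def)
  \<comment> \<open>At \<open>u = 1\<close> the equation collapses to \<open>v\<^sup>2 = a\<close>,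
    whose only root is \<open>a\<^sup>2\<close> because \<open>a ^ 4 = a\<close>.\<close>
  moreover have "n 1 = 1"
  proof -
    have "a\<^sup>2 * a\<^sup>2 = a"
      using a_pow by (simp add: eval_nat_numeral mult.assoc)
    then have "{v. 1 * v * (1 + 1 + v) = a} = {a\<^sup>2}"
      using inj_power2_CHAR_2[OF char, of _ "a\<^sup>2"]
      by (auto simp: char2_simps simp flip: power2_eq_square)
    then show ?thesis
      by (simp add: n_def)
  qed
  moreover have "(\<Sum>u\<in>UNIV-{0,1}. n u) =
      (\<Sum>y\<in>UNIV-{0,1}. 1 + trace_char m a * trace_char m (a * y + 1 / y))"
  proof (rule sum.reindex_bij_witness[of _ "\<lambda>y. 1 / (1 + y)" "\<lambda>u. (1 + u) / u"])
    fix u :: 'a assume u: "u \<in> UNIV - {0, 1}"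
    then have u0: "u \<noteq> 0" and u1: "1 + u \<noteq> 0"
      using add_eq_0_iff_CHAR_2[OF char, of 1 u] by auto
    define y where "y = (1 + u) / u"
    have uy: "u * y = 1 + u" and y0: "y \<noteq> 0"
      using u0 u1 by (auto simp: y_def)
    have y1: "1 + y = 1 / u"
      using u0 by (simp add: y_def field_simps char2_simps)
    show "1 / (1 + (1 + u) / u) = u"
      using y1 by (simp add: y_def)
    show "(1 + u) / u \<in> UNIV - {0, 1}"
      using u0 u1 y1 y0 by (auto simp: y_def[symmetric] char2_simps)
    have "n u = 1 + trace_char m (a / (u * (1 + u)\<^sup>2))"
      using card_quadratic_solutions[OF m card u0 u1] by (simp add: n_def)
    \<comment> \<open>With \<open>1 + u = u * y\<close> the denominator is
      \<open>u ^ 3 * y\<^sup>2\<close>, and \<open>1 / u = 1 + y\<close>.\<close>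
    also have "a / (u * (1 + u)\<^sup>2) = a * (1 + y) ^ 3 / y\<^sup>2"
      using u0 y0 by (simp add: y1 uy[symmetric] field_simps eval_nat_numeral)
    also have "(1 + y) ^ 3 = (1 + y) * (1 + y\<^sup>2)"
      using power2_add_CHAR_2[OF char, of 1 y] by (simp add: eval_nat_numeral)
    also have "a * ((1 + y) * (1 + y\<^sup>2)) / y\<^sup>2 = a * y + a + a / y + a / y\<^sup>2"
      using y0 by (simp add: field_simps power2_eq_square)
    \<comment> \<open>Replacing \<open>a / y\<^sup>2\<close> by its square root
      \<open>a\<^sup>2 / y\<close> leaves the trace unchanged; \<open>a + a\<^sup>2 = 1\<close> then
      merges the two fractions into \<open>1 / y\<close>.\<close>
    also have "trace_char m \<dots> = trace_char m (a * y + a + a / y + a\<^sup>2 / y)"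
    proof -
      have "a / y\<^sup>2 = (a\<^sup>2 / y)\<^sup>2"
        using a_pow by (simp add: power_divide eval_nat_numeral mult.assoc)
      then have "trace_char m (a / y\<^sup>2) = trace_char m (a\<^sup>2 / y)"
        by (simp add: trace_char_def abs_trace_power2[OF card])
      then show ?thesis
        by (simp add: trace_char_add[OF card])
    qed
    also have "a * y + a + a / y + a\<^sup>2 / y = a + (a * y + 1 / y)"
      using a_sum by (simp add: add.assoc add.left_commute add_divide_distrib[symmetric])
    finally show "1 + trace_char m a * trace_char m (a * ((1 + u) / u) + 1 / ((1 + u) / u)) = n u"
      by (simp add: trace_char_add[OF card] y_def)
  next
    fix y :: 'a assume y: "y \<in> UNIV - {0, 1}"
    then have y1: "1 + y \<noteq> 0"
      using add_eq_0_iff_CHAR_2[OF char, of 1 y] by auto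
    then show "(1 + 1 / (1 + y)) / (1 / (1 + y)) = y"
      by (simp add: field_simps char2_simps)
    show "1 / (1 + y) \<in> UNIV - {0, 1}"
      using y y1 by (auto simp: field_simps)
  qed
  moreover have "(\<Sum>y\<in>UNIV-{0,1}. 1 + trace_char m a * trace_char m (a * y + 1 / y)) =
      2 ^ m - 3 + trace_char m a * kloosterman m a"
  proof -
    \<comment> \<open>The split-off term at \<open>y = 1\<close> equals
      \<open>trace_char m a\<close>; multiplied by \<open>trace_char m a\<close> it becomes 1, which
      turns the count \<open>2 ^ m - 2\<close> into \<open>2 ^ m - 3\<close>.\<close>
    have "kloosterman m a = trace_char m (a + 1) + (\<Sum>y\<in>UNIV-{0,1}. trace_char m (a * y + 1 / y))"
      unfolding kloosterman_def trace_char_def[symmetric]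
      by (simp add: sum.remove[of "UNIV-{0}" 1] Diff_insert2[symmetric])
    moreover have "trace_char m (a + 1) = trace_char m a"
    proof -
      have "a + 1 = a\<^sup>2"
        using a_sum by (metis add.commute add_left_self_CHAR_2[OF char])
      then show ?thesis
        by (simp add: trace_char_def abs_trace_power2[OF card])
    qed
    moreover have "trace_char m a * trace_char m a = 1"
      by (simp add: trace_char_eq)
    moreover have "int (card (UNIV - {0, 1::'a})) = 2 ^ m - 2"
      using card card_mono[of UNIV "{0, 1::'a}"] by (simp add: card_Diff_subset of_nat_diff)
    ultimately show ?thesis
      by (simp add: sum.distrib sum_distrib_left[symmetric] algebra_simps)
  qed
  ultimately have "int (card S) = 2 ^ m - 2 + trace_char m a * kloosterman m a"
    by linarith
  then have "3 dvd 2 ^ m - 2 + trace_char m a * kloosterman m a"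
    using dvd by (metis int_dvd_int_iff of_nat_numeral)
  moreover have "3 dvd (2 ^ m - 1 :: int)"
    using card_cong_1_mod_3[OF a a_pow] card by (simp add: cong_iff_dvd_diff flip: cong_int_iff)
  ultimately have "3 dvd (2 ^ m - 2 + trace_char m a * kloosterman m a) - (2 ^ m - 1)"
    by (rule dvd_diff)
  then have "3 dvd trace_char m a * kloosterman m a - 1"
    by simp
  \<comment> \<open>Multiplying by the sign \<open>trace_char m a\<close>, whose square is 1, moves
    it to the other side.\<close>
  then have "3 dvd trace_char m a * (trace_char m a * kloosterman m a - 1)"
    by (rule dvd_mult)
  also have "\<dots> = kloosterman m a - trace_char m a"
    by (simp add: trace_char_eq)
  finally show ?thesis
    by (simp add: cong_iff_dvd_diff)
qed

section \<open>Combination of the two congruences\<close>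

theorem theorem5:
  fixes a :: "'a::{field,finite}" and m :: nat
  assumes "m > 0"
    and "CARD('a) = 2 ^ m"
    and "a \<noteq> 0" and "a \<noteq> 1"
    and "a ^ 3 = 1"
  shows "(abs_trace m a = 0 \<longrightarrow> [kloosterman m a = 7] (mod 12)) \<and>
         (abs_trace m a = 1 \<longrightarrow> [kloosterman m a = 11] (mod 12))"
proof -
  have q: "[2 ^ m = 1] (mod (3::nat))"
    using card_cong_1_mod_3[of a] assms(2,4,5) by simp
  \<comment> \<open>A field of two elements has no primitive cube root of unity: 2 is not 1 modulo
    3.\<close>
  have "m \<noteq> 1"
    using q by (auto simp: cong_def)
  then have "m \<ge> 2"
    using assms(1) by simp
  then have mod4: "[kloosterman m a = 3] (mod 4)"
    using kloosterman_cong_3_mod_4 assms by blast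
  have mod3: "[kloosterman m a = trace_char m a] (mod 3)"
    using kloosterman_cube_root_of_unity_mod_3 assms by blast
  have mod12: "[kloosterman m a = c] (mod 12)"
    if "[c = 3] (mod 4)" "[c = trace_char m a] (mod 3)" for c
  proof -
    have "coprime (4::int) 3"
      by (simp add: coprime_iff_gcd_eq_1 gcd_non_0_int)
    then have "[kloosterman m a = c] (mod (4 * 3))"
      using mod4 mod3 that by (intro coprime_cong_mult) (metis cong_sym cong_trans)+
    then show ?thesis
      by simp
  qed
  \<comment> \<open>Both 7 and 11 are 3 modulo 4; modulo 3 they are 1 and -1, the values of
    \<open>trace_char m a\<close> for trace 0 and 1.\<close>
  show ?thesis
    using mod12[of 7] mod12[of 11] by (auto simp: trace_char_eq cong_def)
qed

end
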